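(* Let $X$ be a non-empty set of positive integers with $X\neq\{1\}$. (i) If $\Delta(X)$ has a subgraph $K_4$, then $B(X)$ contains a subgraph isomorphic to one of $K_{4,1}^\rightarrow$, $\mathtt{Inc}(K_4)$, $\mathcal{K}$ or $\mathcal{G}$. (ii) If $\Gamma(X)$ has a subgraph $K_4$, then $B(X)$ contains a subgraph isomorphic to one of $K_{1,4}^\rightarrow$, $\mathtt{Inc}(K_4)$, $\mathcal{K}$ or $\mathcal{G}$. (iii) If $B(X)$ contains a subgraph isomorphic to one of $K_{1,4}^\rightarrow$, $K_{4,1}^\rightarrow$, $\mathtt{Inc}(K_4)$, $\mathcal{K}$ or $\mathcal{G}$, then at least one of $\Delta(X)$ or $\Gamma(X)$ has a subgraph $K_4$.
   Context: For a non-empty set $X$ of positive integers, $\rho(X)$ is the set of primes dividing some element of $X$ and $X^*=X\setminus\{1\}$. $B(X)$ is the bipartite graph with vertex set the disjoint union $\rho(X)\cup X^*$ and edges $\{p,x\}$ for $p\in\rho(X)$, $x\in X^*$, $p\mid x$. $\Delta(X)$ has vertex set $\rho(X)$, distinct $p,q$ adjacent iff $pq$ divides some element of $X$. $\Gamma(X)$ has vertex set $X^*$, distinct $x,y$ adjacent iff $\gcd(x,y)>1$. Subgraphs need not be induced; $K_4$ is the complete graph on $4$ vertices. $K_{a,b}^\rightarrow$ denotes a complete bipartite subgraph of $B(X)$ with $a$ vertices in $\rho(X)$ and $b$ vertices in $X^*$ (so $K_{4,1}^\rightarrow$ consists of $4$ primes all dividing one element $x\in X^*$, with the $4$ edges to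 $x$; $K_{1,4}^\rightarrow$ consists of one prime dividing $4$ elements of $X^*$). For a graph $(V,E)$, $\mathtt{Inc}$ is the bipartite incidence graph on $V\dot\cup E$ with $\{v,e\}$ an edge iff $v\in V$ is incident with $e\in E$. $\mathcal{K}$ is the bipartite graph with vertices $a,b,c,w,x,y,z$ and the $8$ edges $wa,wb,xa,xb,ya,yc,zb,zc$. $\mathcal{G}$ is the bipartite graph with vertices $u,v,a_1,a_2,a_3,b_1,b_2,b_3$ and the $9$ edges $ub_i$, $va_i$, $a_ib_i$ for $i=1,2,3$. (For $\mathcal{K}$ and $\mathcal{G}$, "isomorphic to a subgraph of $B(X)$" places no restriction on which bipartite half lies in $\rho(X)$.) *)

theory Defs
  imports Complex_Main "HOL-Computational_Algebra.Primes"
begin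

record 'a graph =
  verts :: "'a set"
  edges :: "'a set set"

definition is_graph :: "'a graph \<Rightarrow> bool" where
  "is_graph G \<longleftrightarrow> (\<forall>e \<in> edges G. e \<subseteq> verts G \<and> card e = 2)"

text \<open>Subgraphs are not required to be induced.\<close>

definition is_subgraph :: "'a graph \<Rightarrow> 'a graph \<Rightarrow> bool" where
  "is_subgraph H G \<longleftrightarrow> is_graph H \<and> verts H \<subseteq> verts G \<and> edges H \<subseteq> edges G"

definition graph_iso :: "'a graph \<Rightarrow> 'b graph \<Rightarrow> bool" where
  "graph_iso G H \<longleftrightarrow>
     (\<exists>f. bij_betw f (verts G) (verts H) \<and>
          (\<forall>u \<in> verts G. \<forall>v \<in> verts G. {u, v} \<in> edges G \<longleftrightarrow> {f u, f v} \<in> edges H))"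

definition has_subgraph_iso :: "'a graph \<Rightarrow> 'b graph \<Rightarrow> bool" where
  "has_subgraph_iso G F \<longleftrightarrow> (\<exists>H. is_subgraph H G \<and> graph_iso F H)"

definition complete_graph :: "'a set \<Rightarrow> 'a graph" where
  "complete_graph V = \<lparr>verts = V, edges = {{u, v} | u v. u \<in> V \<and> v \<in> V \<and> u \<noteq> v}\<rparr>"

definition K4 :: "nat graph" where
  "K4 = complete_graph {1, 2, 3, 4}"

definition Inc :: "'a graph \<Rightarrow> ('a + 'a set) graph" where
  "Inc G = \<lparr>verts = verts G <+> edges G,
            edges = {{Inl v, Inr e} | v e. v \<in> verts G \<and> e \<in> edges G \<and> v \<in> e}\<rparr>"

datatype calK_vertex = Ka | Kb | Kc | Kw | Kx | Ky | Kz

definition calK :: "calK_vertex graph" where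
  "calK = \<lparr>verts = {Ka, Kb, Kc, Kw, Kx, Ky, Kz},
           edges = {{Kw, Ka}, {Kw, Kb}, {Kx, Ka}, {Kx, Kb},
                    {Ky, Ka}, {Ky, Kc}, {Kz, Kb}, {Kz, Kc}}\<rparr>"

datatype calG_vertex = Gu | Gv | Ga nat | Gb nat

definition calG :: "calG_vertex graph" where
  "calG = \<lparr>verts = {Gu, Gv} \<union> Ga ` {1, 2, 3} \<union> Gb ` {1, 2, 3},
           edges = (\<Union>i \<in> {1, 2, 3}. {{Gu, Gb i}, {Gv, Ga i}, {Ga i, Gb i}})\<rparr>"

definition rho :: "nat set \<Rightarrow> nat set" where
  "rho X = {p. prime p \<and> (\<exists>x \<in> X. p dvd x)}"

definition star :: "nat set \<Rightarrow> nat set" where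
  "star X = X - {1}"

text \<open>A prime may itself belong to \<open>X\<close>, so the vertex set of the bipartite graph
  is a tagged union: \<open>Inl p\<close> is the prime \<open>p\<close>, \<open>Inr x\<close> is the element \<open>x\<close> of \<open>X\<close>.\<close>

definition B_graph :: "nat set \<Rightarrow> (nat + nat) graph" where
  "B_graph X = \<lparr>verts = rho X <+> star X,
                edges = {{Inl p, Inr x} | p x. p \<in> rho X \<and> x \<in> star X \<and> p dvd x}\<rparr>"

definition Delta_graph :: "nat set \<Rightarrow> nat graph" where
  "Delta_graph X = \<lparr>verts = rho X,
     edges = {{p, q} | p q. p \<in> rho X \<and> q \<in> rho X \<and> p \<noteq> q \<and> (\<exists>x \<in> X. p * q dvd x)}\<rparr>"

definition Gamma_graph :: "nat set \<Rightarrow> nat graph" where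
  "Gamma_graph X = \<lparr>verts = star X,
     edges = {{x, y} | x y. x \<in> star X \<and> y \<in> star X \<and> x \<noteq> y \<and> gcd x y > 1}\<rparr>"

definition complete_bipartite :: "'a set \<Rightarrow> 'b set \<Rightarrow> ('a + 'b) graph" where
  "complete_bipartite P Y = \<lparr>verts = P <+> Y, edges = {{Inl p, Inr y} | p y. p \<in> P \<and> y \<in> Y}\<rparr>"

text \<open>\<open>has_oriented_K X a b\<close>: the bipartite graph of \<open>X\<close> contains a complete bipartite subgraph
  with the \<open>a\<close>-element side among the primes and the \<open>b\<close>-element side among the elements of
  \<open>X\<close> other than 1; the orientation is enforced by the tags.\<close>

definition has_oriented_K :: "nat set \<Rightarrow> nat \<Rightarrow> nat \<Rightarrow> bool" where
  "has_oriented_K X a b \<longleftrightarrow>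
     (\<exists>P Y. finite P \<and> card P = a \<and> finite Y \<and> card Y = b \<and>
            is_subgraph (complete_bipartite P Y) (B_graph X))"

lemma is_graph_complete_graph: "is_graph (complete_graph V)"
  by (auto simp: is_graph_def complete_graph_def card_2_iff)

lemma is_graph_Inc: "is_graph (Inc G)"
  by (auto simp: is_graph_def Inc_def)

lemma is_graph_calK: "is_graph calK"
  by (simp add: is_graph_def calK_def)

lemma is_graph_calG: "is_graph calG"
  by (auto simp: is_graph_def calG_def)

lemma is_graph_B_graph: "is_graph (B_graph X)"
  by (auto simp: is_graph_def B_graph_def)

lemma is_graph_Delta_graph: "is_graph (Delta_graph X)"
  by (auto simp: is_graph_def Delta_graph_def card_2_iff)

lemma is_graph_Gamma_graph: "is_graph (Gamma_graph X)"
  by (auto simp: is_graph_def Gamma_graph_def card_2_iff)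

end

theory Submission
  imports Defs
begin

text \<open>
  A \<open>K4\<close> in \<open>Delta_graph X\<close> or \<open>Gamma_graph X\<close> amounts to four vertices in one half of
  \<open>B_graph X\<close> such that any two of them have a common neighbour. Choose a common neighbour for each
  of the six pairs. If the six choices are distinct, they form \<open>Inc K4\<close>. Otherwise some neighbour
  \<open>x\<close> covers three of the four vertices; if nothing covers all four, the neighbours
  chosen for the three pairs containing the fourth vertex differ from \<open>x\<close>. If those three are
  distinct they give \<open>calG\<close>, and if exactly two of them coincide they give \<open>calK\<close>.
  Conversely, each of the listed graphs contains four vertices that pairwise have common neighbours,
  and such vertices lie in the same half of \<open>B_graph X\<close>.
\<close>

section \<open>Subgraph copies as injective edge-preserving maps\<close>

lemma has_subgraph_iso_iff_embedding:
  assumes "is_graph F"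
  shows "has_subgraph_iso G F \<longleftrightarrow>
    (\<exists>f. inj_on f (verts F) \<and> f ` verts F \<subseteq> verts G \<and> (\<forall>e\<in>edges F. f ` e \<in> edges G))"
    (is "_ \<longleftrightarrow> ?R")
proof
  assume "has_subgraph_iso G F"
  then obtain H f where H: "is_subgraph H G" and f: "bij_betw f (verts F) (verts H)"
    and E: "\<And>u v. u \<in> verts F \<Longrightarrow> v \<in> verts F \<Longrightarrow> {u, v} \<in> edges F \<longleftrightarrow> {f u, f v} \<in> edges H"
    unfolding has_subgraph_iso_def graph_iso_def by blast
  have "f ` e \<in> edges G" if e: "e \<in> edges F" for e
  proof -
    obtain u v where uv: "e = {u, v}" "u \<in> verts F" "v \<in> verts F"
      using assms e unfolding is_graph_def by (metis card_2_iff insert_subset)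
    then show ?thesis
      using E[of u v] e H unfolding is_subgraph_def by auto
  qed
  moreover have "inj_on f (verts F)" "f ` verts F \<subseteq> verts G"
    using f H unfolding bij_betw_def is_subgraph_def by auto
  ultimately show ?R by blast
next
  assume ?R
  then obtain f where f: "inj_on f (verts F)" "f ` verts F \<subseteq> verts G"
    "\<And>e. e \<in> edges F \<Longrightarrow> f ` e \<in> edges G" by blast
  have sub: "e \<subseteq> verts F" "card e = 2" if "e \<in> edges F" for e
    using assms that unfolding is_graph_def by auto
  \<comment> \<open>\<open>H\<close> carries only the images of edges of \<open>F\<close>, not all
    edges of \<open>G\<close> between the image vertices. Hence non-edges of \<open>F\<close> stay
    non-edges of \<open>H\<close>, as \<open>graph_iso\<close> requires.\<close>
  define H where "H = \<lparr>verts = f ` verts F, edges = (`) f ` edges F\<rparr>"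
  have "is_graph H"
    unfolding is_graph_def H_def using sub f(1) by (auto simp: card_image inj_on_subset)
  then have "is_subgraph H G"
    unfolding is_subgraph_def using f by (auto simp: H_def)
  moreover have "graph_iso F H"
    unfolding graph_iso_def
  proof (intro exI[of _ f] conjI ballI)
    show "bij_betw f (verts F) (verts H)" using f(1) by (simp add: bij_betw_def H_def)
    fix u v assume uv: "u \<in> verts F" "v \<in> verts F"
    have "{u, v} \<in> edges F" if "e \<in> edges F" "{f u, f v} = f ` e" for e
    proof -
      have "f ` {u, v} = f ` e" using that by simp
      then have "{u, v} = e"
        using inj_on_image_eq_iff[OF f(1), of "{u, v}" e] uv sub that by auto
      then show ?thesis using that by simp
    qed
    moreover have "{f u, f v} \<in> edges H" if "{u, v} \<in> edges F"
      unfolding H_def using imageI[OF that, of "(`) f"] by simp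
    ultimately show "{u, v} \<in> edges F \<longleftrightarrow> {f u, f v} \<in> edges H"
      by (auto simp: H_def)
  qed
  ultimately show "has_subgraph_iso G F" unfolding has_subgraph_iso_def by blast
qed

lemma verts_K4: "verts K4 = {1, 2, 3, 4}"
  by (simp add: K4_def complete_graph_def)

lemma doubleton_in_edges_K4:
  "{i, j} \<in> edges K4 \<longleftrightarrow> i \<in> verts K4 \<and> j \<in> verts K4 \<and> i \<noteq> j"
  by (auto simp: K4_def complete_graph_def doubleton_eq_iff)

lemma is_graph_K4: "is_graph K4"
  unfolding K4_def by (rule is_graph_complete_graph)

lemma edges_K4E:
  assumes "e \<in> edges K4"
  obtains i j where "e = {i, j}" "i \<in> verts K4" "j \<in> verts K4" "i \<noteq> j"
  using assms by (auto simp: K4_def complete_graph_def)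

lemma other_vertex_K4:
  obtains j where "j \<in> verts K4" "i \<noteq> j"
  using that[of 1] that[of 2] by (cases "i = 1") (auto simp: verts_K4)

lemma has_K4_iff:
  assumes "is_graph G"
  shows "has_subgraph_iso G K4 \<longleftrightarrow>
    (\<exists>f. inj_on f (verts K4) \<and> (\<forall>i\<in>verts K4. \<forall>j\<in>verts K4. i \<noteq> j \<longrightarrow> {f i, f j} \<in> edges G))"
    (is "_ \<longleftrightarrow> (\<exists>f. ?P f)")
proof -
  have "inj_on f (verts K4) \<and> f ` verts K4 \<subseteq> verts G \<and> (\<forall>e\<in>edges K4. f ` e \<in> edges G) \<longleftrightarrow> ?P f" for f
  proof
    assume L: "inj_on f (verts K4) \<and> f ` verts K4 \<subseteq> verts G \<and> (\<forall>e\<in>edges K4. f ` e \<in> edges G)"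
    have "{f i, f j} \<in> edges G" if "i \<in> verts K4" "j \<in> verts K4" "i \<noteq> j" for i j
    proof -
      have "f ` {i, j} \<in> edges G" using L that doubleton_in_edges_K4[of i j] by blast
      then show ?thesis by simp
    qed
    with L show "?P f" by blast
  next
    assume P: "?P f"
    have "f i \<in> verts G" if "i \<in> verts K4" for i
    proof -
      obtain j where "j \<in> verts K4" "i \<noteq> j" by (rule other_vertex_K4)
      then have "{f i, f j} \<in> edges G" using P \<open>i \<in> verts K4\<close> by blast
      then show ?thesis using assms unfolding is_graph_def by blast
    qed
    moreover have "f ` e \<in> edges G" if "e \<in> edges K4" for e
      using that P by (elim edges_K4E) auto
    ultimately show "inj_on f (verts K4) \<and> f ` verts K4 \<subseteq> verts G \<and> (\<forall>e\<in>edges K4. f ` e \<in> edges G)"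
      using P by blast
  qed
  then show ?thesis
    unfolding has_subgraph_iso_iff_embedding[OF is_graph_K4] by presburger
qed

section \<open>Copies of \<open>calK\<close> and \<open>calG\<close>, and the case distinction that
  produces them\<close>

lemma has_subgraph_iso_calK:
  assumes distinct: "distinct [a, b, c, w, x, y, z]" and V: "set [a, b, c, w, x, y, z] \<subseteq> verts G"
    and E: "{w, a} \<in> edges G" "{w, b} \<in> edges G" "{x, a} \<in> edges G" "{x, b} \<in> edges G"
      "{y, a} \<in> edges G" "{y, c} \<in> edges G" "{z, b} \<in> edges G" "{z, c} \<in> edges G"
  shows "has_subgraph_iso G calK"
proof -
  define f where "f = case_calK_vertex a b c w x y z"
  have f: "f Ka = a" "f Kb = b" "f Kc = c" "f Kw = w" "f Kx = x" "f Ky = y" "f Kz = z"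
    by (simp_all add: f_def)
  have verts: "verts calK = set [Ka, Kb, Kc, Kw, Kx, Ky, Kz]"
    by (simp add: calK_def)
  have "distinct (map f [Ka, Kb, Kc, Kw, Kx, Ky, Kz])"
    unfolding list.map f by (rule distinct)
  then have "inj_on f (verts calK)"
    unfolding verts by (simp only: distinct_map)
  moreover have "f ` verts calK \<subseteq> verts G"
    using V by (simp add: verts f)
  moreover have "\<forall>e\<in>edges calK. f ` e \<in> edges G"
    using E by (simp add: calK_def f)
  ultimately show ?thesis
    unfolding has_subgraph_iso_iff_embedding[OF is_graph_calK] by blast
qed

text \<open>The vertices are listed by bipartite halves, \<open>v\<close> with the \<open>b\<close>s
  and \<open>u\<close> with the \<open>a\<close>s, so that distinctness can later be checked one
  half at a time.\<close>

lemma has_subgraph_iso_calG: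
  assumes distinct: "distinct [v, b1, b2, b3, u, a1, a2, a3]"
    and V: "set [v, b1, b2, b3, u, a1, a2, a3] \<subseteq> verts G"
    and E: "{u, b1} \<in> edges G" "{u, b2} \<in> edges G" "{u, b3} \<in> edges G"
      "{v, a1} \<in> edges G" "{v, a2} \<in> edges G" "{v, a3} \<in> edges G"
      "{a1, b1} \<in> edges G" "{a2, b2} \<in> edges G" "{a3, b3} \<in> edges G"
  shows "has_subgraph_iso G calG"
proof -
  \<comment> \<open>Only the indices 1, 2 and 3 occur in \<open>calG\<close>, so the last branch of
    each conditional serves index 3.\<close>
  define f where "f = case_calG_vertex u v
    (\<lambda>m. if m = 1 then a1 else if m = 2 then a2 else a3)
    (\<lambda>m. if m = 1 then b1 else if m = 2 then b2 else b3)"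
  have f: "f Gu = u" "f Gv = v" "f (Ga (Suc 0)) = a1" "f (Ga 2) = a2" "f (Ga 3) = a3"
    "f (Gb (Suc 0)) = b1" "f (Gb 2) = b2" "f (Gb 3) = b3"
    by (simp_all add: f_def)
  have verts: "verts calG = set [Gv, Gb (Suc 0), Gb 2, Gb 3, Gu, Ga (Suc 0), Ga 2, Ga 3]"
    by (auto simp: calG_def)
  have "distinct (map f [Gv, Gb (Suc 0), Gb 2, Gb 3, Gu, Ga (Suc 0), Ga 2, Ga 3])"
    unfolding list.map f by (rule distinct)
  then have "inj_on f (verts calG)"
    unfolding verts by (simp only: distinct_map)
  moreover have "f ` verts calG \<subseteq> verts G"
    using V by (simp add: verts f)
  moreover have "\<forall>e\<in>edges calG. f ` e \<in> edges G"
    using E by (simp add: calG_def f)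
  ultimately show ?thesis
    unfolding has_subgraph_iso_iff_embedding[OF is_graph_calG] by blast
qed

text \<open>The disjoint sets \<open>S\<close> and \<open>T\<close> stand for the two halves of the
  bipartite graph. Keeping them abstract lets the same argument serve for primes and for elements of
  \<open>X\<close>.\<close>

lemma pairwise_common_neighbour_cases:
  fixes G :: "'a graph" and v :: "nat \<Rightarrow> 'a"
  assumes disj: "S \<inter> T = {}" and S: "S \<subseteq> verts G" and T: "T \<subseteq> verts G"
    and inj: "inj_on v (verts K4)" and vS: "\<And>i. i \<in> verts K4 \<Longrightarrow> v i \<in> S"
    and common: "\<And>i j. i \<in> verts K4 \<Longrightarrow> j \<in> verts K4 \<Longrightarrow> i \<noteq> j \<Longrightarrow>
      \<exists>c\<in>T. {v i, c} \<in> edges G \<and> {v j, c} \<in> edges G"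
  shows "(\<exists>c\<in>T. \<forall>i\<in>verts K4. {v i, c} \<in> edges G) \<or> has_subgraph_iso G (Inc K4) \<or>
    has_subgraph_iso G calK \<or> has_subgraph_iso G calG"
proof -
  \<comment> \<open>Choosing by edges of \<open>K4\<close> rather than by ordered pairs gives
    exactly one neighbour for each unordered pair.\<close>
  have "\<forall>e\<in>edges K4. \<exists>c. c \<in> T \<and> (\<forall>i\<in>e. {v i, c} \<in> edges G)"
  proof
    fix e assume "e \<in> edges K4"
    then obtain i j where "e = {i, j}" "i \<in> verts K4" "j \<in> verts K4" "i \<noteq> j" by (rule edges_K4E)
    then show "\<exists>c. c \<in> T \<and> (\<forall>i\<in>e. {v i, c} \<in> edges G)" using common[of i j] by auto
  qed
  from bchoice[OF this] obtain c where c: "\<And>e. e \<in> edges K4 \<Longrightarrow> c e \<in> T"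
      "\<And>e i. e \<in> edges K4 \<Longrightarrow> i \<in> e \<Longrightarrow> {v i, c e} \<in> edges G"
    by blast
  show ?thesis
  proof (cases "inj_on c (edges K4)")
    case True
    have "inj_on (case_sum v c) (verts (Inc K4))"
    proof (rule inj_onI)
      fix s t assume st: "s \<in> verts (Inc K4)" "t \<in> verts (Inc K4)" "case_sum v c s = case_sum v c t"
      \<comment> \<open>Images of vertices lie in \<open>S\<close> and images of edges in
        \<open>T\<close>, so they cannot collide.\<close>
      have "v i \<noteq> c e" if "i \<in> verts K4" "e \<in> edges K4" for i e
        using vS[OF that(1)] c(1)[OF that(2)] disj by auto
      then show "s = t"
        using st by (cases s; cases t)
          (auto simp: Inc_def inj_on_eq_iff[OF inj] inj_on_eq_iff[OF True] dest: sym)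
    qed
    moreover have "case_sum v c ` verts (Inc K4) \<subseteq> verts G"
      using S T vS c(1) by (auto simp: Inc_def)
    moreover have "\<forall>e\<in>edges (Inc K4). case_sum v c ` e \<in> edges G"
      using c(2) by (auto simp: Inc_def)
    ultimately have "has_subgraph_iso G (Inc K4)"
      unfolding has_subgraph_iso_iff_embedding[OF is_graph_Inc] by blast
    then show ?thesis by blast
  next
    case False
    then obtain e e' where e: "e \<in> edges K4" "e' \<in> edges K4" "e \<noteq> e'" "c e = c e'"
      unfolding inj_on_def by blast
    obtain i j where ij: "e = {i, j}" "i \<in> verts K4" "j \<in> verts K4" "i \<noteq> j"
      using e(1) by (rule edges_K4E)
    \<comment> \<open>Two different 2-element sets are not nested, so \<open>e'\<close> has an
      endpoint \<open>k\<close> outside \<open>e\<close>, and the shared choice is adjacent to the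
      images of \<open>i\<close>, \<open>j\<close> and \<open>k\<close>. Whether \<open>e\<close>
      and \<open>e'\<close> meet does not matter.\<close>
    obtain k where k: "k \<in> e'" "k \<notin> e"
      using e(2,3) ij by (elim edges_K4E) (auto simp: doubleton_eq_iff)
    have kV: "k \<in> verts K4" using k e(2) by (auto elim: edges_K4E)
    have "\<exists>l. verts K4 = {i, j, k, l} \<and> l \<noteq> i \<and> l \<noteq> j \<and> l \<noteq> k"
    proof -
      have "card {i, j, k} = 3" "{i, j, k} \<subseteq> verts K4" using ij kV k by auto
      moreover have "card (verts K4) = 4" by (simp add: verts_K4)
      ultimately have "card (verts K4 - {i, j, k}) = 1" by (simp add: card_Diff_subset)
      then obtain l where "verts K4 - {i, j, k} = {l}" by (auto simp: card_1_singleton_iff)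
      then show ?thesis using ij kV by (intro exI[of _ l]) blast
    qed
    then obtain l where l: "verts K4 = {i, j, k, l}" "l \<noteq> i" "l \<noteq> j" "l \<noteq> k" by blast
    define x where "x = c e"
    have x: "x \<in> T" "{v i, x} \<in> edges G" "{v j, x} \<in> edges G" "{v k, x} \<in> edges G"
      unfolding x_def using c(1)[OF e(1)] c(2)[OF e(1), of i] c(2)[OF e(1), of j]
        c(2)[OF e(2), of k] e(4) ij(1) k(1) by simp_all
    show ?thesis
    proof (cases "\<exists>c\<in>T. \<forall>i\<in>verts K4. {v i, c} \<in> edges G")
      case no4: False
      have lk: "\<exists>y\<in>T. {v m, y} \<in> edges G \<and> {v l, y} \<in> edges G" if "m \<in> {i, j, k}" for m
        using common[of m l] l that by auto
      obtain yi where yi: "yi \<in> T" "{v i, yi} \<in> edges G" "{v l, yi} \<in> edges G" using lk by blast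
      obtain yj where yj: "yj \<in> T" "{v j, yj} \<in> edges G" "{v l, yj} \<in> edges G" using lk by blast
      obtain yk where yk: "yk \<in> T" "{v k, yk} \<in> edges G" "{v l, yk} \<in> edges G" using lk by blast
      \<comment> \<open>Adjacency of \<open>x\<close> to \<open>v l\<close> would make
        \<open>x\<close> a neighbour of all four. This separates \<open>x\<close> from
        \<open>yi\<close>, \<open>yj\<close> and \<open>yk\<close>, which are adjacent to
        \<open>v l\<close>.\<close>
      have xl: "{v l, x} \<notin> edges G" using no4 x l(1) by auto
      then have xy: "x \<noteq> yi" "x \<noteq> yj" "x \<noteq> yk" using yi yj yk by auto
      have vv: "v i \<noteq> v j" "v i \<noteq> v k" "v i \<noteq> v l" "v j \<noteq> v k" "v j \<noteq> v l" "v k \<noteq> v l"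
        using ij k l by (auto simp: inj_on_eq_iff[OF inj])
      have vS': "v i \<in> S" "v j \<in> S" "v k \<in> S" "v l \<in> S" using vS l(1) by auto
      \<comment> \<open>All three ways in which two of the chosen neighbours coincide are handled at
        once: \<open>y\<close> is the one shared by \<open>p\<close> and \<open>q\<close>, and
        \<open>z\<close> belongs to \<open>r\<close>. Here \<open>x\<close>, \<open>y\<close>,
        \<open>z\<close> play \<open>Ka\<close>, \<open>Kb\<close>, \<open>Kc\<close>, and
        \<open>p\<close>, \<open>q\<close>, \<open>r\<close>, \<open>v l\<close> play
        \<open>Kw\<close>, \<open>Kx\<close>, \<open>Ky\<close>, \<open>Kz\<close>.\<close>
      have calK: "has_subgraph_iso G calK"
        if "y \<in> T" "z \<in> T" "distinct [x, y, z]" "set [p, q, r] = {v i, v j, v k}" "distinct [p, q, r]"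
          "{p, y} \<in> edges G" "{q, y} \<in> edges G" "{v l, y} \<in> edges G"
          "{r, z} \<in> edges G" "{v l, z} \<in> edges G" for y z p q r
      proof (rule has_subgraph_iso_calK)
        have xyz: "set [x, y, z] \<subseteq> T" using that(1,2) x(1) by simp
        have "set [p, q, r] \<subseteq> S" unfolding that(4) using vS' by simp
        then have pqrl: "set [p, q, r, v l] \<subseteq> S" using vS'(4) by simp
        have "v l \<notin> set [p, q, r]" unfolding that(4) using vv by auto
        then have "distinct [p, q, r, v l]" using that(5) by auto
        moreover have "set [x, y, z] \<inter> set [p, q, r, v l] = {}" using xyz pqrl disj by blast
        ultimately have "distinct ([x, y, z] @ [p, q, r, v l])"
          unfolding distinct_append using that(3) by blast
        then show "distinct [x, y, z, p, q, r, v l]" by (simp only: append_Cons append_Nil)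
        have "set ([x, y, z] @ [p, q, r, v l]) \<subseteq> verts G"
          unfolding set_append using xyz pqrl S T by blast
        then show "set [x, y, z, p, q, r, v l] \<subseteq> verts G" by (simp only: append_Cons append_Nil)
        have "{s, x} \<in> edges G" if "s \<in> set [p, q, r]" for s
          using that x(2-4) unfolding \<open>set [p, q, r] = _\<close> by blast
        then show "{p, x} \<in> edges G" "{q, x} \<in> edges G" "{r, x} \<in> edges G" by simp_all
      qed (use that in simp_all)
      consider (ij) "yi = yj" | (ik) "yi = yk" | (jk) "yj = yk"
        | (distinct) "yi \<noteq> yj" "yi \<noteq> yk" "yj \<noteq> yk" by blast
      then show ?thesis
      proof cases
        case ij
        \<comment> \<open>If all three coincided, that vertex would be adjacent to all four.\<close>
        then have "yi \<noteq> yk" using no4 yi yj yk l(1) by auto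
        then have "has_subgraph_iso G calK"
          using calK[of yi yk "v i" "v j" "v k"] ij yi yj yk xy vv by auto
        then show ?thesis by blast
      next
        case ik
        then have "yi \<noteq> yj" using no4 yi yj yk l(1) by auto
        then have "has_subgraph_iso G calK"
          using calK[of yi yj "v i" "v k" "v j"] ik yi yj yk xy vv by auto
        then show ?thesis by blast
      next
        case jk
        then have "yj \<noteq> yi" using no4 yi yj yk l(1) by auto
        then have "has_subgraph_iso G calK"
          using calK[of yj yi "v j" "v k" "v i"] jk yi yj yk xy vv by auto
        then show ?thesis by blast
      next
        case distinct
        have "has_subgraph_iso G calG"
        \<comment> \<open>The roles are \<open>x\<close> for \<open>Gv\<close>, the three neighbours
          of \<open>v l\<close> for the \<open>Gb\<close>s, \<open>v l\<close> for
          \<open>Gu\<close>, and \<open>v i\<close>, \<open>v j\<close>, \<open>v k\<close> for the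
          \<open>Ga\<close>s.\<close>
        proof (rule has_subgraph_iso_calG)
          have xy_T: "set [x, yi, yj, yk] \<subseteq> T" using x(1) yi(1) yj(1) yk(1) by simp
          have v_S: "set [v l, v i, v j, v k] \<subseteq> S" using vS' by simp
          have "distinct [x, yi, yj, yk]" "distinct [v l, v i, v j, v k]"
            using distinct xy vv by auto
          moreover have "set [x, yi, yj, yk] \<inter> set [v l, v i, v j, v k] = {}"
            using xy_T v_S disj by blast
          ultimately have "distinct ([x, yi, yj, yk] @ [v l, v i, v j, v k])"
            unfolding distinct_append by blast
          then show "distinct [x, yi, yj, yk, v l, v i, v j, v k]"
            by (simp only: append_Cons append_Nil)
          have "set ([x, yi, yj, yk] @ [v l, v i, v j, v k]) \<subseteq> verts G"
            unfolding set_append using xy_T v_S S T by blast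
          then show "set [x, yi, yj, yk, v l, v i, v j, v k] \<subseteq> verts G"
            by (simp only: append_Cons append_Nil)
        qed (use x yi yj yk in \<open>simp_all add: insert_commute\<close>)
        then show ?thesis by blast
      qed
    qed blast
  qed
qed

section \<open>Adjacency in \<open>Delta_graph\<close> and \<open>Gamma_graph\<close> as common
  neighbours in \<open>B_graph\<close>\<close>

lemma edges_B_graph_iff [simp]:
  "{Inl p, Inr x} \<in> edges (B_graph X) \<longleftrightarrow> p \<in> rho X \<and> x \<in> star X \<and> p dvd x"
  by (auto simp: B_graph_def doubleton_eq_iff)

lemma edges_B_graph_not_same_side [simp]:
  "{Inl p, Inl q} \<notin> edges (B_graph X)" "{Inr x, Inr y} \<notin> edges (B_graph X)"
  by (auto simp: B_graph_def doubleton_eq_iff)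

text \<open>Distinct primes are coprime, so their product divides \<open>x\<close> exactly when both
  do. A number with a prime divisor is not 1, which allows passing from \<open>X\<close> to
  \<open>star X\<close>.\<close>

lemma edges_Delta_graph_iff:
  assumes "p \<noteq> q"
  shows "{p, q} \<in> edges (Delta_graph X) \<longleftrightarrow>
    (\<exists>x. {Inl p, Inr x} \<in> edges (B_graph X) \<and> {Inl q, Inr x} \<in> edges (B_graph X))"
proof -
  have "{p, q} \<in> edges (Delta_graph X) \<longleftrightarrow> p \<in> rho X \<and> q \<in> rho X \<and> (\<exists>x\<in>X. p * q dvd x)"
    (is "?L \<longleftrightarrow> ?R")
  proof
    assume ?L
    then obtain p' q' x where *: "{p, q} = {p', q'}" "p' \<in> rho X" "q' \<in> rho X" "x \<in> X" "p' * q' dvd x"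
      by (auto simp: Delta_graph_def)
    then have "p * q = p' * q'" "p \<in> rho X" "q \<in> rho X"
      by (auto simp: doubleton_eq_iff)
    with * show ?R by auto
  next
    assume ?R
    then show ?L using assms unfolding Delta_graph_def by auto
  qed
  also have "\<dots> \<longleftrightarrow> p \<in> rho X \<and> q \<in> rho X \<and> (\<exists>x\<in>star X. p dvd x \<and> q dvd x)"
  proof -
    have "(x \<in> X \<and> p * q dvd x) \<longleftrightarrow> (x \<in> star X \<and> p dvd x \<and> q dvd x)"
      if "p \<in> rho X" "q \<in> rho X" for x
    proof -
      have pq: "prime p" "prime q" using that by (auto simp: rho_def)
      then have "coprime p q" using assms by (simp add: primes_coprime)
      then have "p * q dvd x \<longleftrightarrow> p dvd x \<and> q dvd x"
        using divides_mult[of p x q] dvd_mult_left[of p q x] dvd_mult_right[of p q x] by blast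
      moreover have "\<not> p dvd 1" using pq by auto
      ultimately show ?thesis by (auto simp: star_def)
    qed
    then show ?thesis by blast
  qed
  finally show ?thesis by auto
qed

text \<open>A gcd above 1 has a prime factor, and this prime is the common neighbour.\<close>

lemma edges_Gamma_graph_iff:
  assumes "x \<noteq> y"
  shows "{x, y} \<in> edges (Gamma_graph X) \<longleftrightarrow>
    (\<exists>p. {Inl p, Inr x} \<in> edges (B_graph X) \<and> {Inl p, Inr y} \<in> edges (B_graph X))"
proof -
  have "{x, y} \<in> edges (Gamma_graph X) \<longleftrightarrow> x \<in> star X \<and> y \<in> star X \<and> gcd x y > 1"
    (is "?L \<longleftrightarrow> ?R")
  proof
    assume ?L
    then obtain x' y' where *: "{x, y} = {x', y'}" "x' \<in> star X" "y' \<in> star X" "gcd x' y' > 1"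
      by (auto simp: Gamma_graph_def)
    then have "gcd x y = gcd x' y'" "x \<in> star X" "y \<in> star X"
      by (auto simp: doubleton_eq_iff gcd.commute)
    with * show ?R by simp
  next
    assume ?R
    then show ?L using assms unfolding Gamma_graph_def by auto
  qed
  also have "gcd x y > 1 \<longleftrightarrow> (\<exists>p. prime p \<and> p dvd x \<and> p dvd y)"
  proof
    assume "gcd x y > 1"
    then show "\<exists>p. prime p \<and> p dvd x \<and> p dvd y"
      using prime_factor_nat[of "gcd x y"] by auto
  next
    assume "\<exists>p. prime p \<and> p dvd x \<and> p dvd y"
    then have "gcd x y \<noteq> 1" by (metis gcd_greatest not_prime_unit)
    \<comment> \<open>The gcd vanishes only if both numbers are 0, which contradicts their being
      distinct.\<close>
    moreover have "gcd x y \<noteq> 0" using assms by auto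
    ultimately show "gcd x y > 1" by linarith
  qed
  finally show ?thesis by (auto simp: rho_def star_def)
qed

section \<open>From pairwise common neighbours back to a complete graph on four vertices\<close>

lemma K4_if_pairwise_common_neighbour_in_B_graph:
  assumes inj: "inj_on v (verts K4)"
    and common: "\<And>i j. i \<in> verts K4 \<Longrightarrow> j \<in> verts K4 \<Longrightarrow> i < j \<Longrightarrow>
      \<exists>c. {v i, c} \<in> edges (B_graph X) \<and> {v j, c} \<in> edges (B_graph X)"
  shows "has_subgraph_iso (Delta_graph X) K4 \<or> has_subgraph_iso (Gamma_graph X) K4"
proof -
  \<comment> \<open>Having a common neighbour is symmetric, so the six pairs with
    \<open>i < j\<close> give all ordered pairs.\<close>
  have common': "\<exists>c. {v i, c} \<in> edges (B_graph X) \<and> {v j, c} \<in> edges (B_graph X)"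
    if "i \<in> verts K4" "j \<in> verts K4" "i \<noteq> j" for i j
    using common[of i j] common[of j i] that by (cases i j rule: linorder_cases) auto
  \<comment> \<open>Edges join \<open>Inl\<close> to \<open>Inr\<close> only, so sharing a neighbour
    with \<open>v 1\<close> forces the same tag. The tag of \<open>v 1\<close> then decides between
    \<open>Delta_graph\<close> and \<open>Gamma_graph\<close>.\<close>
  have side: "isl (v i) = isl (v 1)" if i: "i \<in> verts K4" for i
  proof (cases "i = 1")
    case False
    then obtain c where "{v i, c} \<in> edges (B_graph X)" "{v 1, c} \<in> edges (B_graph X)"
      using common'[OF i, of 1] by (auto simp: verts_K4)
    then show ?thesis by (cases "v i"; cases "v 1"; cases c) auto
  qed simp
  show ?thesis
  proof (cases "isl (v 1)")
    case True
    then have v: "v i = Inl (projl (v i))" if "i \<in> verts K4" for i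
      using side[OF that] by simp
    have inj': "inj_on (\<lambda>i. projl (v i)) (verts K4)"
    proof (rule inj_onI)
      fix i j assume ij: "i \<in> verts K4" "j \<in> verts K4" "projl (v i) = projl (v j)"
      then have "v i = v j" using v[OF ij(1)] v[OF ij(2)] by simp
      then show "i = j" using inj ij by (simp add: inj_on_eq_iff)
    qed
    have "{projl (v i), projl (v j)} \<in> edges (Delta_graph X)"
      if ij: "i \<in> verts K4" "j \<in> verts K4" "i \<noteq> j" for i j
    proof -
      obtain c where c: "{Inl (projl (v i)), c} \<in> edges (B_graph X)"
          "{Inl (projl (v j)), c} \<in> edges (B_graph X)"
        using common'[OF ij] v[OF ij(1)] v[OF ij(2)] by auto
      moreover have "projl (v i) \<noteq> projl (v j)" using inj' ij by (auto simp: inj_on_def)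
      ultimately show ?thesis by (cases c) (auto simp: edges_Delta_graph_iff)
    qed
    with inj' have "has_subgraph_iso (Delta_graph X) K4"
      unfolding has_K4_iff[OF is_graph_Delta_graph]
      by (intro exI[of _ "\<lambda>i. projl (v i)"]) blast
    then show ?thesis by blast
  next
    case False
    then have v: "v i = Inr (projr (v i))" if "i \<in> verts K4" for i
      using side[OF that] by simp
    have inj': "inj_on (\<lambda>i. projr (v i)) (verts K4)"
    proof (rule inj_onI)
      fix i j assume ij: "i \<in> verts K4" "j \<in> verts K4" "projr (v i) = projr (v j)"
      then have "v i = v j" using v[OF ij(1)] v[OF ij(2)] by simp
      then show "i = j" using inj ij by (simp add: inj_on_eq_iff)
    qed
    have "{projr (v i), projr (v j)} \<in> edges (Gamma_graph X)"
      if ij: "i \<in> verts K4" "j \<in> verts K4" "i \<noteq> j" for i j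
    proof -
      \<comment> \<open>The edges are turned round so that the prime comes first, the form in which
        adjacency in \<open>B_graph\<close> is characterised.\<close>
      obtain c where c: "{c, Inr (projr (v i))} \<in> edges (B_graph X)"
          "{c, Inr (projr (v j))} \<in> edges (B_graph X)"
        using common'[OF ij] v[OF ij(1)] v[OF ij(2)] by (auto simp: insert_commute)
      moreover have "projr (v i) \<noteq> projr (v j)" using inj' ij by (auto simp: inj_on_def)
      ultimately show ?thesis by (cases c) (auto simp: edges_Gamma_graph_iff)
    qed
    with inj' have "has_subgraph_iso (Gamma_graph X) K4"
      unfolding has_K4_iff[OF is_graph_Gamma_graph]
      by (intro exI[of _ "\<lambda>i. projr (v i)"]) blast
    then show ?thesis by blast
  qed
qed

text \<open>An embedding carries common neighbours to common neighbours, so it is enough to find the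
  four vertices inside the abstract graph \<open>F\<close>.\<close>

lemma K4_if_pairwise_common_neighbour:
  assumes F: "is_graph F" "has_subgraph_iso (B_graph X) F"
    and w: "inj_on w (verts K4)" "w ` verts K4 \<subseteq> verts F"
    and common: "\<And>i j. i \<in> verts K4 \<Longrightarrow> j \<in> verts K4 \<Longrightarrow> i < j \<Longrightarrow>
      \<exists>c. {w i, c} \<in> edges F \<and> {w j, c} \<in> edges F"
  shows "has_subgraph_iso (Delta_graph X) K4 \<or> has_subgraph_iso (Gamma_graph X) K4"
proof -
  obtain f where f: "inj_on f (verts F)" "\<And>e. e \<in> edges F \<Longrightarrow> f ` e \<in> edges (B_graph X)"
    using F has_subgraph_iso_iff_embedding by metis
  show ?thesis
  proof (rule K4_if_pairwise_common_neighbour_in_B_graph)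
    show "inj_on (f \<circ> w) (verts K4)"
      using w f(1) by (meson comp_inj_on inj_on_subset)
    fix i j assume "i \<in> verts K4" "j \<in> verts K4" "i < j"
    then obtain c where "{w i, c} \<in> edges F" "{w j, c} \<in> edges F" using common by blast
    then show "\<exists>c. {(f \<circ> w) i, c} \<in> edges (B_graph X) \<and> {(f \<circ> w) j, c} \<in> edges (B_graph X)"
      using f(2)[of "{w i, c}"] f(2)[of "{w j, c}"] by (intro exI[of _ "f c"]) simp
  qed
qed

lemma K4_if_Inc_K4:
  assumes "has_subgraph_iso (B_graph X) (Inc K4)"
  shows "has_subgraph_iso (Delta_graph X) K4 \<or> has_subgraph_iso (Gamma_graph X) K4"
proof (rule K4_if_pairwise_common_neighbour[OF is_graph_Inc assms, of Inl])
  fix i j assume ij: "i \<in> verts K4" "j \<in> verts K4" "i < j"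
  then have "{i, j} \<in> edges K4" by (simp add: doubleton_in_edges_K4)
  \<comment> \<open>The incidence vertex of the edge \<open>{i, j}\<close> is adjacent to both of
    its endpoints.\<close>
  then show "\<exists>c. {Inl i, c} \<in> edges (Inc K4) \<and> {Inl j, c} \<in> edges (Inc K4)"
    using ij by (intro exI[of _ "Inr {i, j}"]) (auto simp: Inc_def)
qed (auto simp: Inc_def)

lemma K4_if_four_vertices:
  assumes F: "is_graph F" "has_subgraph_iso (B_graph X) F"
    and w: "distinct [w1, w2, w3, w4]" "set [w1, w2, w3, w4] \<subseteq> verts F"
    and common: "\<exists>c. {w1, c} \<in> edges F \<and> {w2, c} \<in> edges F" "\<exists>c. {w1, c} \<in> edges F \<and> {w3, c} \<in> edges F"
      "\<exists>c. {w1, c} \<in> edges F \<and> {w4, c} \<in> edges F" "\<exists>c. {w2, c} \<in> edges F \<and> {w3, c} \<in> edges F"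
      "\<exists>c. {w2, c} \<in> edges F \<and> {w4, c} \<in> edges F" "\<exists>c. {w3, c} \<in> edges F \<and> {w4, c} \<in> edges F"
  shows "has_subgraph_iso (Delta_graph X) K4 \<or> has_subgraph_iso (Gamma_graph X) K4"
proof -
  define f where "f = (\<lambda>i::nat. if i = 1 then w1 else if i = 2 then w2 else if i = 3 then w3 else w4)"
  have f: "f 1 = w1" "f 2 = w2" "f 3 = w3" "f 4 = w4" by (simp_all add: f_def)
  have verts: "verts K4 = set [1, 2, 3, 4]" by (simp add: verts_K4)
  show ?thesis
  proof (rule K4_if_pairwise_common_neighbour[OF F, of f])
    have "distinct (map f [1, 2, 3, 4])" unfolding list.map f by (rule w(1))
    then show "inj_on f (verts K4)" unfolding verts by (simp only: distinct_map)
    have "set (map f [1, 2, 3, 4]) \<subseteq> verts F" unfolding list.map f by (rule w(2))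
    then show "f ` verts K4 \<subseteq> verts F" unfolding verts by (simp only: set_map)
    fix i j assume "i \<in> verts K4" "j \<in> verts K4" "i < j"
    then consider "i = 1" "j = 2" | "i = 1" "j = 3" | "i = 1" "j = 4" | "i = 2" "j = 3"
      | "i = 2" "j = 4" | "i = 3" "j = 4"
      by (auto simp: verts_K4)
    then show "\<exists>c. {f i, c} \<in> edges F \<and> {f j, c} \<in> edges F"
      by cases (simp_all only: f common)
  qed
qed

text \<open>The four vertices are \<open>Kw\<close>, \<open>Kx\<close>, \<open>Ky\<close>,
  \<open>Kz\<close>: the first three meet in \<open>Ka\<close>, while \<open>Kw\<close>,
  \<open>Kx\<close>, \<open>Kz\<close> meet in \<open>Kb\<close>, and the remaining pair
  \<open>Ky\<close>, \<open>Kz\<close> meets in \<open>Kc\<close>.\<close>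

lemma K4_if_calK:
  assumes "has_subgraph_iso (B_graph X) calK"
  shows "has_subgraph_iso (Delta_graph X) K4 \<or> has_subgraph_iso (Gamma_graph X) K4"
proof (rule K4_if_four_vertices[OF is_graph_calK assms])
  have E: "{Kw, Ka} \<in> edges calK" "{Kw, Kb} \<in> edges calK" "{Kx, Ka} \<in> edges calK" "{Kx, Kb} \<in> edges calK"
    "{Ky, Ka} \<in> edges calK" "{Ky, Kc} \<in> edges calK" "{Kz, Kb} \<in> edges calK" "{Kz, Kc} \<in> edges calK"
    by (simp_all add: calK_def)
  show "\<exists>c. {Kw, c} \<in> edges calK \<and> {Kx, c} \<in> edges calK" "\<exists>c. {Kw, c} \<in> edges calK \<and> {Ky, c} \<in> edges calK"
    "\<exists>c. {Kw, c} \<in> edges calK \<and> {Kz, c} \<in> edges calK" "\<exists>c. {Kx, c} \<in> edges calK \<and> {Ky, c} \<in> edges calK"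
    "\<exists>c. {Kx, c} \<in> edges calK \<and> {Kz, c} \<in> edges calK" "\<exists>c. {Ky, c} \<in> edges calK \<and> {Kz, c} \<in> edges calK"
    using E by blast+
qed (simp_all add: calK_def)

text \<open>The four vertices are the three \<open>Ga\<close>s and \<open>Gu\<close>: the
  \<open>Ga\<close>s all meet in \<open>Gv\<close>, and \<open>Ga i\<close> meets \<open>Gu\<close>
  in \<open>Gb i\<close>.\<close>

lemma K4_if_calG:
  assumes "has_subgraph_iso (B_graph X) calG"
  shows "has_subgraph_iso (Delta_graph X) K4 \<or> has_subgraph_iso (Gamma_graph X) K4"
proof (rule K4_if_four_vertices[OF is_graph_calG assms])
  have E: "{Gu, Gb i} \<in> edges calG" "{Ga i, Gv} \<in> edges calG" "{Ga i, Gb i} \<in> edges calG"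
    if "i \<in> {1, 2, 3}" for i
  proof -
    have "{{Gu, Gb i}, {Gv, Ga i}, {Ga i, Gb i}} \<subseteq> edges calG"
      unfolding calG_def graph.simps by (rule UN_upper[OF that])
    then show "{Gu, Gb i} \<in> edges calG" "{Ga i, Gv} \<in> edges calG" "{Ga i, Gb i} \<in> edges calG"
      by (simp_all only: insert_commute[of "Ga i" Gv] insert_subset)
  qed
  have a: "\<exists>c. {Ga i, c} \<in> edges calG \<and> {Ga j, c} \<in> edges calG"
    if "i \<in> {1, 2, 3}" "j \<in> {1, 2, 3}" for i j
    using E(2)[OF that(1)] E(2)[OF that(2)] by blast
  show "\<exists>c. {Ga 1, c} \<in> edges calG \<and> {Ga 2, c} \<in> edges calG"
    "\<exists>c. {Ga 1, c} \<in> edges calG \<and> {Ga 3, c} \<in> edges calG"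
    "\<exists>c. {Ga 2, c} \<in> edges calG \<and> {Ga 3, c} \<in> edges calG"
    by (rule a; simp)+
  have u: "\<exists>c. {Ga i, c} \<in> edges calG \<and> {Gu, c} \<in> edges calG" if "i \<in> {1, 2, 3}" for i
    using E[OF that] by blast
  show "\<exists>c. {Ga 1, c} \<in> edges calG \<and> {Gu, c} \<in> edges calG"
    "\<exists>c. {Ga 2, c} \<in> edges calG \<and> {Gu, c} \<in> edges calG"
    "\<exists>c. {Ga 3, c} \<in> edges calG \<and> {Gu, c} \<in> edges calG"
    by (rule u; simp)+
qed (simp_all add: calG_def)

section \<open>Oriented complete bipartite subgraphs\<close>

lemma is_subgraph_complete_bipartite_iff:
  assumes "P \<noteq> {}" "Y \<noteq> {}"
  shows "is_subgraph (complete_bipartite P Y) (B_graph X) \<longleftrightarrow>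
    (\<forall>p\<in>P. \<forall>y\<in>Y. {Inl p, Inr y} \<in> edges (B_graph X))"
proof -
  have "is_graph (complete_bipartite P Y)"
    by (auto simp: is_graph_def complete_bipartite_def)
  moreover have "edges (complete_bipartite P Y) \<subseteq> edges (B_graph X) \<longleftrightarrow>
      (\<forall>p\<in>P. \<forall>y\<in>Y. {Inl p, Inr y} \<in> edges (B_graph X))"
    by (auto simp: complete_bipartite_def simp del: edges_B_graph_iff)
  \<comment> \<open>With both sides non-empty every vertex lies on an edge, so the edges already
    force the vertices into \<open>B_graph X\<close>.\<close>
  moreover have "verts (complete_bipartite P Y) \<subseteq> verts (B_graph X)"
    if "\<forall>p\<in>P. \<forall>y\<in>Y. {Inl p, Inr y} \<in> edges (B_graph X)"
    using that assms by (auto simp: complete_bipartite_def B_graph_def doubleton_eq_iff)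
  ultimately show ?thesis unfolding is_subgraph_def by blast
qed

text \<open>Indexing four-element sets by the vertices of \<open>K4\<close> brings the oriented
  subgraphs into the form used in \<open>has_K4_iff\<close>.\<close>

lemma card_4_iff_image_K4:
  "card A = 4 \<longleftrightarrow> (\<exists>f. inj_on f (verts K4) \<and> A = f ` verts K4)"
proof
  assume "card A = 4"
  then have "finite A" "card (verts K4) = card A" by (auto simp: verts_K4 card_ge_0_finite)
  then obtain f where "bij_betw f (verts K4) A"
    using finite_same_card_bij[of "verts K4" A] by (auto simp: verts_K4)
  then show "\<exists>f. inj_on f (verts K4) \<and> A = f ` verts K4" by (auto simp: bij_betw_def)
next
  assume "\<exists>f. inj_on f (verts K4) \<and> A = f ` verts K4"
  then show "card A = 4" by (auto simp: card_image) (simp add: verts_K4)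
qed

lemma has_oriented_K_4_1_iff:
  "has_oriented_K X 4 1 \<longleftrightarrow>
    (\<exists>p x. inj_on p (verts K4) \<and> (\<forall>i\<in>verts K4. {Inl (p i), Inr x} \<in> edges (B_graph X)))"
proof -
  have ne: "verts K4 \<noteq> {}" "finite (verts K4)" by (auto simp: verts_K4)
  have "has_oriented_K X 4 1 \<longleftrightarrow>
      (\<exists>p x. inj_on p (verts K4) \<and> is_subgraph (complete_bipartite (p ` verts K4) {x}) (B_graph X))"
    (is "_ \<longleftrightarrow> ?R")
  proof
    assume "has_oriented_K X 4 1"
    then show ?R
      unfolding has_oriented_K_def card_4_iff_image_K4 One_nat_def card_1_singleton_iff by metis
  next
    assume ?R
    then obtain p x where "inj_on p (verts K4)" "is_subgraph (complete_bipartite (p ` verts K4) {x}) (B_graph X)"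
      by blast
    then show "has_oriented_K X 4 1"
      unfolding has_oriented_K_def using ne
      by (intro exI[of _ "p ` verts K4"] exI[of _ "{x}"]) (auto simp: card_4_iff_image_K4)
  qed
  then show ?thesis using ne by (simp add: is_subgraph_complete_bipartite_iff)
qed

lemma has_oriented_K_1_4_iff:
  "has_oriented_K X 1 4 \<longleftrightarrow>
    (\<exists>p x. inj_on x (verts K4) \<and> (\<forall>i\<in>verts K4. {Inl p, Inr (x i)} \<in> edges (B_graph X)))"
proof -
  have ne: "verts K4 \<noteq> {}" "finite (verts K4)" by (auto simp: verts_K4)
  have "has_oriented_K X 1 4 \<longleftrightarrow>
      (\<exists>p x. inj_on x (verts K4) \<and> is_subgraph (complete_bipartite {p} (x ` verts K4)) (B_graph X))"
    (is "_ \<longleftrightarrow> ?R")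
  proof
    assume "has_oriented_K X 1 4"
    then show ?R
      unfolding has_oriented_K_def card_4_iff_image_K4 One_nat_def card_1_singleton_iff by metis
  next
    assume ?R
    then obtain p x where "inj_on x (verts K4)" "is_subgraph (complete_bipartite {p} (x ` verts K4)) (B_graph X)"
      by blast
    then show "has_oriented_K X 1 4"
      unfolding has_oriented_K_def using ne
      by (intro exI[of _ "{p}"] exI[of _ "x ` verts K4"]) (auto simp: card_4_iff_image_K4)
  qed
  then show ?thesis using ne by (simp add: is_subgraph_complete_bipartite_iff)
qed

text \<open>The single element \<open>x\<close> is a common neighbour for every pair of the four
  primes.\<close>

lemma K4_if_oriented_K_4_1:
  assumes "has_oriented_K X 4 1"
  shows "has_subgraph_iso (Delta_graph X) K4"
proof -
  obtain p x where "inj_on p (verts K4)" "\<forall>i\<in>verts K4. {Inl (p i), Inr x} \<in> edges (B_graph X)"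
    using assms unfolding has_oriented_K_4_1_iff by blast
  then show ?thesis
    unfolding has_K4_iff[OF is_graph_Delta_graph]
    by (intro exI[of _ p]) (metis edges_Delta_graph_iff inj_on_eq_iff)
qed

lemma K4_if_oriented_K_1_4:
  assumes "has_oriented_K X 1 4"
  shows "has_subgraph_iso (Gamma_graph X) K4"
proof -
  obtain p x where "inj_on x (verts K4)" "\<forall>i\<in>verts K4. {Inl p, Inr (x i)} \<in> edges (B_graph X)"
    using assms unfolding has_oriented_K_1_4_iff by blast
  then show ?thesis
    unfolding has_K4_iff[OF is_graph_Gamma_graph]
    by (intro exI[of _ x]) (metis edges_Gamma_graph_iff inj_on_eq_iff)
qed

section \<open>The case distinction applied to each half of \<open>B_graph\<close>\<close>

lemma B_graph_sides:
  "Inl ` rho X \<inter> Inr ` star X = {}" "Inl ` rho X \<subseteq> verts (B_graph X)"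
  "Inr ` star X \<subseteq> verts (B_graph X)"
  by (auto simp: B_graph_def)

text \<open>Here \<open>S\<close> consists of the tagged primes and \<open>T\<close> of the tagged
  elements, so a neighbour common to all four gives the orientation with four primes and one
  element.\<close>

lemma Delta_graph_K4_cases:
  assumes "has_subgraph_iso (Delta_graph X) K4"
  shows "has_oriented_K X 4 1 \<or> has_subgraph_iso (B_graph X) (Inc K4) \<or>
    has_subgraph_iso (B_graph X) calK \<or> has_subgraph_iso (B_graph X) calG"
proof -
  obtain p where p: "inj_on p (verts K4)"
    and E: "\<And>i j. i \<in> verts K4 \<Longrightarrow> j \<in> verts K4 \<Longrightarrow> i \<noteq> j \<Longrightarrow> {p i, p j} \<in> edges (Delta_graph X)"
    using assms unfolding has_K4_iff[OF is_graph_Delta_graph] by blast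
  have common: "\<exists>c\<in>Inr ` star X. {Inl (p i), c} \<in> edges (B_graph X) \<and> {Inl (p j), c} \<in> edges (B_graph X)"
    if "i \<in> verts K4" "j \<in> verts K4" "i \<noteq> j" for i j
    using E[OF that] p that by (auto simp: edges_Delta_graph_iff inj_on_eq_iff)
  \<comment> \<open>Any edge of \<open>B_graph X\<close> at \<open>Inl (p i)\<close> shows that
    \<open>p i\<close> is in \<open>rho X\<close>, and one exists since \<open>i\<close> has a
    partner in \<open>K4\<close>.\<close>
  have side: "Inl (p i) \<in> Inl ` rho X" if i: "i \<in> verts K4" for i
  proof -
    obtain j where "j \<in> verts K4" "i \<noteq> j" by (rule other_vertex_K4)
    then show ?thesis using common[OF i] by auto
  qed
  have "inj_on (\<lambda>i. Inl (p i)) (verts K4)" using p by (simp add: inj_on_def)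
  from pairwise_common_neighbour_cases[OF B_graph_sides this side common]
  show ?thesis using p unfolding has_oriented_K_4_1_iff by blast
qed

text \<open>The two halves exchange roles, so a neighbour common to all four is now a prime. Edges
  are reversed where needed because the case distinction writes the four vertices first.\<close>

lemma Gamma_graph_K4_cases:
  assumes "has_subgraph_iso (Gamma_graph X) K4"
  shows "has_oriented_K X 1 4 \<or> has_subgraph_iso (B_graph X) (Inc K4) \<or>
    has_subgraph_iso (B_graph X) calK \<or> has_subgraph_iso (B_graph X) calG"
proof -
  obtain x where x: "inj_on x (verts K4)"
    and E: "\<And>i j. i \<in> verts K4 \<Longrightarrow> j \<in> verts K4 \<Longrightarrow> i \<noteq> j \<Longrightarrow> {x i, x j} \<in> edges (Gamma_graph X)"
    using assms unfolding has_K4_iff[OF is_graph_Gamma_graph] by blast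
  have common: "\<exists>c\<in>Inl ` rho X. {Inr (x i), c} \<in> edges (B_graph X) \<and> {Inr (x j), c} \<in> edges (B_graph X)"
    if "i \<in> verts K4" "j \<in> verts K4" "i \<noteq> j" for i j
    using E[OF that] x that
    by (auto simp: edges_Gamma_graph_iff inj_on_eq_iff insert_commute[of "Inr _" "Inl _"])
  have side: "Inr (x i) \<in> Inr ` star X" if i: "i \<in> verts K4" for i
  proof -
    obtain j where "j \<in> verts K4" "i \<noteq> j" by (rule other_vertex_K4)
    then show ?thesis using common[OF i] by (auto simp: insert_commute[of "Inr _" "Inl _"])
  qed
  have "inj_on (\<lambda>i. Inr (x i)) (verts K4)" using x by (simp add: inj_on_def)
  from pairwise_common_neighbour_cases[OF _ B_graph_sides(3,2) this side common] B_graph_sides(1)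
  have "(\<exists>c\<in>Inl ` rho X. \<forall>i\<in>verts K4. {Inr (x i), c} \<in> edges (B_graph X)) \<or>
      has_subgraph_iso (B_graph X) (Inc K4) \<or>
      has_subgraph_iso (B_graph X) calK \<or> has_subgraph_iso (B_graph X) calG"
    by blast
  then show ?thesis
    using x unfolding has_oriented_K_1_4_iff insert_commute[of "Inl _" "Inr _"] by blast
qed

theorem theorem4p6:
  fixes X :: "nat set"
  assumes "X \<noteq> {}" and "\<forall>x \<in> X. 0 < x" and "X \<noteq> {1}"
  shows "(has_subgraph_iso (Delta_graph X) K4 \<longrightarrow>
            has_oriented_K X 4 1 \<or> has_subgraph_iso (B_graph X) (Inc K4) \<or>
            has_subgraph_iso (B_graph X) calK \<or> has_subgraph_iso (B_graph X) calG)
       \<and> (has_subgraph_iso (Gamma_graph X) K4 \<longrightarrow>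
            has_oriented_K X 1 4 \<or> has_subgraph_iso (B_graph X) (Inc K4) \<or>
            has_subgraph_iso (B_graph X) calK \<or> has_subgraph_iso (B_graph X) calG)
       \<and> (has_oriented_K X 1 4 \<or> has_oriented_K X 4 1 \<or> has_subgraph_iso (B_graph X) (Inc K4) \<or>
            has_subgraph_iso (B_graph X) calK \<or> has_subgraph_iso (B_graph X) calG \<longrightarrow>
            has_subgraph_iso (Delta_graph X) K4 \<or> has_subgraph_iso (Gamma_graph X) K4)"
  using Delta_graph_K4_cases Gamma_graph_K4_cases K4_if_oriented_K_1_4 K4_if_oriented_K_4_1
    K4_if_Inc_K4 K4_if_calK K4_if_calG by blast

end
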